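(* Let $q$ be a prime power, $n\geq2$, $1\neq\sigma\in\mathrm{Aut}(\mathbb F_q)$ with fixed field $\mathbb F_s$, and $m(r)=\frac{q^{n+1-r}-1}{q-1}+\frac{s^r-1}{s-1}$. The maximum of $\theta_M$ over nonzero $M\in M_{n+1}(q)$ (i.e. the maximum number of points $[\xi]\in\mathrm{PG}(V^* )$ with $\ker(\xi^\sigma)\subseteq\ker(\xi M)$) is (1) $m(3)=s^2+s+1$ if $\sigma^2=1$ and $n=2$; (2) $m(1)=\frac{q^n-1}{q-1}+1$ if $\sigma^2\neq1$ or $n>2$.
   Context: $V^*=\mathbb F_q^{n+1}$ (row vectors), $V=\mathbb F_q^{n+1}$ (column vectors); $\xi^\sigma$ is $\xi$ with $\sigma$ applied coordinatewise; $\ker\eta=\{x\in V:\eta x=0\}$ (equal to $V$ if $\eta=0$). $\theta_M$ denotes the number of points $[\xi]\in\mathrm{PG}(V^* )$ with $\ker(\xi^\sigma)\subseteq\ker(\xi M)$. *)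

theory Defs
  imports "HOL-Analysis.Analysis"
begin

definition field_automorphism :: "('a::field \<Rightarrow> 'a) \<Rightarrow> bool" where
  "field_automorphism \<sigma> \<longleftrightarrow>
     bij \<sigma> \<and> \<sigma> 1 = 1 \<and> (\<forall>x y. \<sigma> (x + y) = \<sigma> x + \<sigma> y) \<and> (\<forall>x y. \<sigma> (x * y) = \<sigma> x * \<sigma> y)"

definition fixed_field :: "('a::field \<Rightarrow> 'a) \<Rightarrow> 'a set" where
  "fixed_field \<sigma> = {x. \<sigma> x = x}"

(* Row vectors and column vectors are both of type 'a ^ 'n; a row vector acts on a
   matrix from the left by v*. *)

definition map_coords :: "('a \<Rightarrow> 'a) \<Rightarrow> 'a ^ 'n \<Rightarrow> 'a ^ 'n" where
  "map_coords \<sigma> \<xi> = (\<chi> i. \<sigma> (\<xi> $ i))"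

definition row_ker :: "('a::field) ^ 'n \<Rightarrow> ('a ^ 'n) set" where
  "row_ker \<eta> = {x. scalar_product \<eta> x = 0}"

(* The point of the projective space spanned by a nonzero vector, as a one-dimensional subspace. *)
definition proj_point :: "('a::field) ^ 'n \<Rightarrow> ('a ^ 'n) set" where
  "proj_point \<xi> = vec.span {\<xi>}"

lemma row_ker_scale:
  assumes "c \<noteq> 0"
  shows "row_ker (c *s \<eta>) = row_ker \<eta>"
  using assms by (simp add: row_ker_def scalar_product_def mult.assoc flip: sum_distrib_left)

(* The defining condition of theta depends only on the point, not on its representative. *)
lemma theta_condition_scale:
  fixes M :: "('a::field) ^ 'n ^ 'n"
  assumes "field_automorphism \<sigma>" "c \<noteq> 0"
  shows "row_ker (map_coords \<sigma> (c *s \<xi>)) \<subseteq> row_ker ((c *s \<xi>) v* M) \<longleftrightarrow>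
         row_ker (map_coords \<sigma> \<xi>) \<subseteq> row_ker (\<xi> v* M)"
proof -
  have mult: "\<sigma> (x * y) = \<sigma> x * \<sigma> y" for x y
    using assms(1) by (simp add: field_automorphism_def)
  have "\<sigma> c * \<sigma> (inverse c) = 1"
    using assms by (simp add: field_automorphism_def flip: mult)
  then have "\<sigma> c \<noteq> 0" by auto
  moreover have "map_coords \<sigma> (c *s \<xi>) = \<sigma> c *s map_coords \<sigma> \<xi>"
    by (simp add: map_coords_def vec_eq_iff mult)
  moreover have "(c *s \<xi>) v* M = c *s (\<xi> v* M)"
    by (simp add: vector_matrix_mult_def vec_eq_iff sum_distrib_left mult_ac)
  ultimately show ?thesis using \<open>c \<noteq> 0\<close> by (simp add: row_ker_scale)
qed

definition theta :: "('a::field \<Rightarrow> 'a) \<Rightarrow> 'a ^ 'n ^ 'n \<Rightarrow> nat" where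
  "theta \<sigma> M =
     card {proj_point \<xi> | \<xi>. \<xi> \<noteq> 0 \<and> row_ker (map_coords \<sigma> \<xi>) \<subseteq> row_ker (\<xi> v* M)}"

(* Only used for r <= n + 1, so the exponent n + 1 - r is not truncated. *)
definition m_val :: "nat \<Rightarrow> nat \<Rightarrow> nat \<Rightarrow> nat \<Rightarrow> real" where
  "m_val q s n r = (real q ^ (n + 1 - r) - 1) / (real q - 1) + (real s ^ r - 1) / (real s - 1)"

end

theory Submission
  imports Defs
begin

text \<open>
  The condition on \<open>\<xi>\<close> says \<open>\<xi>M = c\<xi>\<^sup>\<sigma>\<close> for some scalar \<open>c\<close>. Let \<open>B\<close> be a maximal linearly
  independent set of such vectors with \<open>c \<noteq> 0\<close>. If \<open>\<xi> = \<Sum>a\<^sub>b b\<close> is another one, then comparing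
  coefficients in \<open>\<xi>M = c\<xi>\<^sup>\<sigma>\<close> gives \<open>a\<^sub>b c\<^sub>b = c \<sigma>(a\<^sub>b)\<close>, so once one coefficient is normalised to 1
  each of the others takes at most \<open>s\<close> values. Hence there are at most \<open>1 + s + \<dots> + s\<^sup>m\<^sup>-\<^sup>1\<close> such
  points, \<open>m = |B|\<close>. The span of \<open>B\<close> meets the left kernel of \<open>M\<close>, of dimension \<open>k \<le> n\<close>, trivially, so
  \<open>k + m \<le> n + 1\<close>, and it remains to maximise the sum of the two geometric sums. The extreme values are
  attained by the identity matrix and by a diagonal matrix unit. The comparison of \<open>q\<close> with
  \<open>s\<^sup>2\<close> and \<open>s\<^sup>3\<close> is elementary linear algebra over the fixed field.
\<close>

section \<open>Automorphisms and their fixed fields\<close>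

lemma field_automorphism_id: "field_automorphism id"
  by (simp add: field_automorphism_def)

lemma fixed_field_id: "fixed_field id = UNIV"
  by (simp add: fixed_field_def)

context
  fixes \<sigma> :: "'a::field \<Rightarrow> 'a"
  assumes aut: "field_automorphism \<sigma>"
begin

lemma aut_add: "\<sigma> (x + y) = \<sigma> x + \<sigma> y"
  and aut_mult: "\<sigma> (x * y) = \<sigma> x * \<sigma> y"
  and aut_one: "\<sigma> 1 = 1"
  and aut_bij: "bij \<sigma>"
  using aut by (auto simp: field_automorphism_def)

lemma aut_zero: "\<sigma> 0 = 0"
  using aut_add[of 0 0] by (metis add_cancel_right_right)

lemma aut_eq_zero_iff: "\<sigma> x = 0 \<longleftrightarrow> x = 0"
  using bij_is_inj[OF aut_bij] aut_zero by (metis injD)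

lemma aut_diff: "\<sigma> (x - y) = \<sigma> x - \<sigma> y"
  using aut_add[of "x - y" y] by (simp add: algebra_simps)

lemma aut_divide: "\<sigma> (x / y) = \<sigma> x / \<sigma> y"
proof (cases "y = 0")
  case False
  then show ?thesis
    using aut_mult[of "x / y" y] by (simp add: field_simps aut_eq_zero_iff)
qed (simp add: aut_zero)

lemma map_coords_zero: "map_coords \<sigma> 0 = 0"
  and map_coords_add: "map_coords \<sigma> (x + y) = map_coords \<sigma> x + map_coords \<sigma> y"
  and map_coords_scale: "map_coords \<sigma> (c *s x) = \<sigma> c *s map_coords \<sigma> x"
  and map_coords_eq_zero_iff: "map_coords \<sigma> x = 0 \<longleftrightarrow> x = 0"
  by (simp_all add: map_coords_def vec_eq_iff aut_add aut_mult aut_zero aut_eq_zero_iff)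

lemma map_coords_sum: "map_coords \<sigma> (\<Sum>w\<in>B. f w) = (\<Sum>w\<in>B. map_coords \<sigma> (f w))"
  by (induction B rule: infinite_finite_induct) (simp_all add: map_coords_zero map_coords_add)

lemma fixed_field_closed:
  assumes "x \<in> fixed_field \<sigma>" "y \<in> fixed_field \<sigma>"
  shows "x - y \<in> fixed_field \<sigma>" "x / y \<in> fixed_field \<sigma>"
  using assms by (simp_all add: fixed_field_def aut_diff aut_divide)

lemma zero_one_in_fixed_field: "0 \<in> fixed_field \<sigma>" "1 \<in> fixed_field \<sigma>"
  by (simp_all add: fixed_field_def aut_zero aut_one)

end

context
  fixes \<sigma> :: "'a::{field,finite} \<Rightarrow> 'a"
  assumes aut: "field_automorphism \<sigma>"
begin

lemma card_fixed_field_ge_2: "2 \<le> card (fixed_field \<sigma>)"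
proof -
  have "card {0::'a, 1} \<le> card (fixed_field \<sigma>)"
    using zero_one_in_fixed_field[OF aut] by (intro card_mono) auto
  then show ?thesis by simp
qed

text \<open>The quotient of a solution by a fixed nonzero solution is invariant under \<sigma>, so
  the solutions lie on one line over the fixed field. This is the source of the powers of
  \<open>s\<close> in the final count.\<close>

lemma card_twisted_solutions_le:
  assumes "c \<noteq> 0"
  shows "card {x. x * a = c * \<sigma> x} \<le> card (fixed_field \<sigma>)"
proof (cases "\<exists>x0. x0 * a = c * \<sigma> x0 \<and> x0 \<noteq> 0")
  case True
  then obtain x0 where x0: "x0 * a = c * \<sigma> x0" "x0 \<noteq> 0" by blast
  have "\<sigma> x0 \<noteq> 0" using x0 aut_eq_zero_iff[OF aut] by simp
  have "x / x0 \<in> fixed_field \<sigma>" if "x * a = c * \<sigma> x" for x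
  proof -
    have "c * (\<sigma> x * x0) = x * (x0 * a)" using that by (simp add: mult_ac)
    also have "\<dots> = c * (\<sigma> x0 * x)" using x0 by (simp add: mult_ac)
    finally have "\<sigma> x * x0 = \<sigma> x0 * x" using assms by simp
    then show ?thesis
      using x0 \<open>\<sigma> x0 \<noteq> 0\<close> by (simp add: fixed_field_def aut_divide[OF aut] field_simps)
  qed
  then show ?thesis
    using x0 by (intro card_inj_on_le[where f = "\<lambda>x. x / x0"]) (auto intro!: inj_onI)
next
  case False
  then have "{x. x * a = c * \<sigma> x} \<subseteq> {0}" by auto
  then have "card {x. x * a = c * \<sigma> x} \<le> 1" using card_mono[of "{0::'a}"] by fastforce
  then show ?thesis using card_fixed_field_ge_2 by simp
qed

section \<open>Comparing the field with its fixed field by means of an element moved by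
  \<sigma>\<close>

context
  fixes a :: 'a
  assumes a: "\<sigma> a \<noteq> a"
begin

text \<open>Linear independence of 1 and \<open>a\<close> over the fixed field: a nontrivial
  relation would exhibit \<open>a\<close> as a quotient of fixed elements.\<close>

lemma fixed_field_pair_unique:
  assumes "x \<in> fixed_field \<sigma>" "y \<in> fixed_field \<sigma>" "x' \<in> fixed_field \<sigma>" "y' \<in> fixed_field \<sigma>"
    and eq: "x + y * a = x' + y' * a"
  shows "x = x' \<and> y = y'"
proof -
  have "y = y'"
  proof (rule ccontr)
    assume ne: "y \<noteq> y'"
    have "a * (y - y') = x' - x" using eq by (simp add: algebra_simps)
    then have "a = (x' - x) / (y - y')" using ne by (simp add: field_simps)
    then have "a \<in> fixed_field \<sigma>" using fixed_field_closed[OF aut] assms by simp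
    then show False using a by (simp add: fixed_field_def)
  qed
  then show ?thesis using eq by simp
qed

lemma card_fixed_field_square_le: "card (fixed_field \<sigma>) ^ 2 \<le> CARD('a)"
proof -
  have "inj_on (\<lambda>p. fst p + snd p * a) (fixed_field \<sigma> \<times> fixed_field \<sigma>)"
  proof (rule inj_onI)
    fix p p' assume "p \<in> fixed_field \<sigma> \<times> fixed_field \<sigma>" "p' \<in> fixed_field \<sigma> \<times> fixed_field \<sigma>"
      "fst p + snd p * a = fst p' + snd p' * a"
    then show "p = p'"
      using fixed_field_pair_unique[of "fst p" "snd p" "fst p'" "snd p'"]
      by (simp add: mem_Times_iff prod_eq_iff)
  qed
  then have "card (fixed_field \<sigma> \<times> fixed_field \<sigma>) \<le> CARD('a)"
    by (intro card_inj_on_le) auto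
  then show ?thesis by (simp add: card_cartesian_product power2_eq_square)
qed

text \<open>For an involution, \<open>x + \<sigma> x\<close> is a trace and hence fixed. The map
  sending \<open>x\<close> to the traces of \<open>x\<close> and \<open>a * x\<close> is injective,
  since the linear system for \<open>x\<close> and \<open>\<sigma> x\<close> has determinant
  \<open>\<sigma> a - a\<close>, which is nonzero.\<close>

lemma card_le_fixed_field_square:
  assumes "\<sigma> \<circ> \<sigma> = id"
  shows "CARD('a) \<le> card (fixed_field \<sigma>) ^ 2"
proof -
  have inv: "\<sigma> (\<sigma> x) = x" for x using assms by (simp add: fun_eq_iff)
  let ?f = "\<lambda>x. (x + \<sigma> x, a * x + \<sigma> a * \<sigma> x)"
  have "inj ?f"
  proof (rule injI)
    fix x y assume "?f x = ?f y"
    then have "\<sigma> x + x = \<sigma> y + y" and 2: "a * x + \<sigma> a * \<sigma> x = a * y + \<sigma> a * \<sigma> y"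
      by (auto simp: add.commute)
    then have "\<sigma> x = \<sigma> y + y - x" by (simp add: eq_diff_eq)
    with 2 have "(\<sigma> a - a) * (y - x) = 0" by (simp add: algebra_simps)
    then show "x = y" using a by simp
  qed
  moreover have "range ?f \<subseteq> fixed_field \<sigma> \<times> fixed_field \<sigma>"
    by (auto simp: fixed_field_def aut_add[OF aut] aut_mult[OF aut] inv)
  ultimately have "CARD('a) \<le> card (fixed_field \<sigma> \<times> fixed_field \<sigma>)"
    by (intro card_inj_on_le) auto
  then show ?thesis by (simp add: card_cartesian_product power2_eq_square)
qed

text \<open>If \<open>a\<close> generated a quadratic extension, \<open>\<sigma> a\<close> would be the other root of its minimal
  polynomial, which would force \<open>\<sigma> \<circ> \<sigma> = id\<close>.\<close>

lemma card_fixed_field_cube_le: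
  assumes "\<sigma> \<circ> \<sigma> \<noteq> id"
  shows "card (fixed_field \<sigma>) ^ 3 \<le> CARD('a)"
proof -
  let ?T = "fixed_field \<sigma>"
  have "\<exists>b. \<forall>x\<in>?T. \<forall>y\<in>?T. b \<noteq> x + y * a"
  proof (rule ccontr)
    assume "\<not> ?thesis"
    then have ex: "\<exists>x\<in>?T. \<exists>y\<in>?T. b = x + y * a" for b by blast
    obtain u v where uv: "u \<in> ?T" "v \<in> ?T" "a * a = u + v * a" using ex by blast
    have "\<sigma> a * \<sigma> a = u + v * \<sigma> a"
      using uv(1,2) arg_cong[OF uv(3), of \<sigma>]
      by (simp add: aut_add[OF aut] aut_mult[OF aut] fixed_field_def)
    then have "(a - \<sigma> a) * (a + \<sigma> a - v) = 0" using uv(3) by (simp add: algebra_simps)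
    then have "a + \<sigma> a = v" using a by auto
    then have "\<sigma> (a + \<sigma> a) = a + \<sigma> a" using uv(2) by (simp add: fixed_field_def)
    then have aa: "\<sigma> (\<sigma> a) = a" by (simp add: aut_add[OF aut])
    have "\<sigma> (\<sigma> b) = b" for b
      using ex[of b] by (auto simp: fixed_field_def aut_add[OF aut] aut_mult[OF aut] aa)
    then show False using assms by (auto simp: fun_eq_iff)
  qed
  then obtain b where b: "\<And>x y. x \<in> ?T \<Longrightarrow> y \<in> ?T \<Longrightarrow> b \<noteq> x + y * a" by blast
  \<comment> \<open>Since \<open>b\<close> is outside the span of 1 and \<open>a\<close>, the
    elements 1, \<open>a\<close>, \<open>b\<close> are independent over the fixed field, so their
    combinations give \<open>s ^ 3\<close> distinct elements.\<close>
  have unique: "x = x' \<and> y = y' \<and> z = z'"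
    if T: "x \<in> ?T" "y \<in> ?T" "z \<in> ?T" "x' \<in> ?T" "y' \<in> ?T" "z' \<in> ?T"
      and eq: "x + y * a + z * b = x' + y' * a + z' * b" for x y z x' y' z'
  proof -
    have z: "z = z'"
    proof (rule ccontr)
      assume ne: "z \<noteq> z'"
      have "b * (z - z') = (x' - x) + (y' - y) * a" using eq by (simp add: algebra_simps)
      then have "b = ((x' - x) + (y' - y) * a) / (z - z')" using ne by (simp add: eq_divide_eq)
      then have "b = (x' - x) / (z - z') + (y' - y) / (z - z') * a"
        by (simp add: add_divide_distrib)
      moreover have "(x' - x) / (z - z') \<in> ?T" "(y' - y) / (z - z') \<in> ?T"
        using T by (auto intro!: fixed_field_closed[OF aut])
      ultimately show False using b by metis
    qed
    show "x = x' \<and> y = y' \<and> z = z'"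
      using z eq fixed_field_pair_unique[of x y x' y'] T by auto
  qed
  have "inj_on (\<lambda>p. fst p + fst (snd p) * a + snd (snd p) * b) (?T \<times> ?T \<times> ?T)"
  proof (rule inj_onI)
    fix p p' assume "p \<in> ?T \<times> ?T \<times> ?T" "p' \<in> ?T \<times> ?T \<times> ?T"
      "fst p + fst (snd p) * a + snd (snd p) * b = fst p' + fst (snd p') * a + snd (snd p') * b"
    then show "p = p'"
      using unique[of "fst p" "fst (snd p)" "snd (snd p)" "fst p'" "fst (snd p')" "snd (snd p')"]
      by (simp add: mem_Times_iff prod_eq_iff)
  qed
  then have "card (?T \<times> ?T \<times> ?T) \<le> CARD('a)"
    by (intro card_inj_on_le) auto
  then show ?thesis by (simp add: card_cartesian_product power3_eq_cube)
qed

end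

end

section \<open>The point condition as a twisted eigenvector equation\<close>

text \<open>With \<open>\<zeta> $ i\<close> nonzero, the vectors
  \<open>\<zeta> $ i *s axis j 1 - \<zeta> $ j *s axis i 1\<close> lie in the kernel of \<zeta>.
  That \<eta> kills them too says that \<eta> is proportional to \<zeta>.\<close>

lemma row_ker_subset_iff:
  fixes \<zeta> \<eta> :: "'a::field ^ 'n"
  assumes "\<zeta> \<noteq> 0"
  shows "row_ker \<zeta> \<subseteq> row_ker \<eta> \<longleftrightarrow> (\<exists>c. \<eta> = c *s \<zeta>)"
proof
  assume sub: "row_ker \<zeta> \<subseteq> row_ker \<eta>"
  obtain i where i: "\<zeta> $ i \<noteq> 0" using assms by (auto simp: vec_eq_iff)
  have ax: "(\<Sum>k\<in>UNIV. z $ k * (t * axis j 1 $ k)) = t * z $ j" for z :: "'a ^ 'n" and t j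
  proof -
    have "(\<Sum>k\<in>UNIV. z $ k * (t * axis j 1 $ k)) = (\<Sum>k\<in>UNIV. if k = j then t * z $ j else 0)"
      by (intro sum.cong) (auto simp: axis_def)
    then show ?thesis by simp
  qed
  have *: "scalar_product z (\<zeta> $ i *s axis j 1 - \<zeta> $ j *s axis i 1) = \<zeta> $ i * z $ j - \<zeta> $ j * z $ i"
    for z j
    by (simp add: scalar_product_def right_diff_distrib sum_subtractf ax)
  have "\<zeta> $ i * \<eta> $ j = \<zeta> $ j * \<eta> $ i" for j
  proof -
    have "\<zeta> $ i *s axis j 1 - \<zeta> $ j *s axis i 1 \<in> row_ker \<zeta>"
      by (simp add: row_ker_def *)
    then have "\<zeta> $ i *s axis j 1 - \<zeta> $ j *s axis i 1 \<in> row_ker \<eta>" using sub by blast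
    then show ?thesis by (simp add: row_ker_def *)
  qed
  then have "\<eta> = (\<eta> $ i / \<zeta> $ i) *s \<zeta>" using i by (simp add: vec_eq_iff field_simps)
  then show "\<exists>c. \<eta> = c *s \<zeta>" ..
next
  assume "\<exists>c. \<eta> = c *s \<zeta>"
  then show "row_ker \<zeta> \<subseteq> row_ker \<eta>"
    by (auto simp: row_ker_def scalar_product_def mult.assoc simp flip: sum_distrib_left)
qed

text \<open>The scalar \<open>c\<close> may be 0, so the points of the left kernel of
  \<open>M\<close> are counted as well.\<close>

lemma theta_eq:
  fixes M :: "'a::field ^ 'n ^ 'n"
  assumes "field_automorphism \<sigma>"
  shows "theta \<sigma> M = card (proj_point ` {\<xi>. \<xi> \<noteq> 0 \<and> (\<exists>c. \<xi> v* M = c *s map_coords \<sigma> \<xi>)})"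
proof -
  have "(\<xi> \<noteq> 0 \<and> row_ker (map_coords \<sigma> \<xi>) \<subseteq> row_ker (\<xi> v* M)) \<longleftrightarrow>
        (\<xi> \<noteq> 0 \<and> (\<exists>c. \<xi> v* M = c *s map_coords \<sigma> \<xi>))" for \<xi>
    using map_coords_eq_zero_iff[OF assms] row_ker_subset_iff by metis
  then show ?thesis by (simp add: theta_def image_def) metis
qed

lemma proj_point_scale:
  assumes "c \<noteq> 0"
  shows "proj_point (c *s \<xi>) = proj_point \<xi>"
proof -
  have "x *s \<xi> = (x / c) *s (c *s \<xi>)" for x using assms by (simp add: vector_smult_assoc)
  then have "range (\<lambda>x. x *s \<xi>) \<subseteq> range (\<lambda>x. x *s (c *s \<xi>))" by fast
  then show ?thesis by (auto simp: proj_point_def vec.span_singleton vector_smult_assoc)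
qed

lemma proj_point_eqD: "proj_point \<xi> = proj_point \<eta> \<Longrightarrow> \<exists>c. \<eta> = c *s \<xi>"
  using vec.span_superset[of "{\<eta>}"] by (auto simp: proj_point_def vec.span_singleton)

section \<open>Counting points in the span of independent eigenvectors\<close>

text \<open>Applying \<sigma> to coordinates is an injective semilinear map. As \<sigma> is
  surjective, a relation between the images pulls back through \<open>inv \<sigma>\<close> to one
  between the vectors of \<open>B\<close>.\<close>

lemma independent_map_coords:
  fixes B :: "('a::field ^ 'n) set"
  assumes aut: "field_automorphism \<sigma>" and ind: "vec.independent B" and fin: "finite B"
    and eq: "(\<Sum>w\<in>B. h w *s map_coords \<sigma> w) = 0" and "w \<in> B"
  shows "h w = 0"
proof -
  have inv: "\<sigma> (inv \<sigma> x) = x" for x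
    using aut_bij[OF aut] by (simp add: bij_is_surj surj_f_inv_f)
  have "map_coords \<sigma> (\<Sum>w\<in>B. inv \<sigma> (h w) *s w) = 0"
    using eq by (simp add: map_coords_sum[OF aut] map_coords_scale[OF aut] inv)
  then have "(\<Sum>w\<in>B. inv \<sigma> (h w) *s w) = 0"
    by (simp add: map_coords_eq_zero_iff[OF aut])
  then have "inv \<sigma> (h w) = 0" 
    using vec.independentD[OF ind fin subset_refl, of "\<lambda>w. inv \<sigma> (h w)"] \<open>w \<in> B\<close> by simp
  then show ?thesis using inv aut_zero[OF aut] by metis
qed

lemma vector_matrix_mult_sum: "(\<Sum>w\<in>B. f w) v* M = (\<Sum>w\<in>B. f w v* M)"
  by (induction B rule: infinite_finite_induct) (simp_all add: algebra_simps)

text \<open>Both sides of the equation expand in the independent vectors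
  \<open>map_coords \<sigma> w\<close>. The case \<open>c = 0\<close> is included and serves to
  separate the span of \<open>B\<close> from the left kernel.\<close>

lemma eigenvector_coefficients:
  fixes B :: "('a::field ^ 'n) set"
  assumes aut: "field_automorphism \<sigma>" and ind: "vec.independent B" and fin: "finite B"
    and eig: "\<And>b. b \<in> B \<Longrightarrow> b v* M = l b *s map_coords \<sigma> b"
    and v: "(\<Sum>w\<in>B. g w *s w) v* M = c *s map_coords \<sigma> (\<Sum>w\<in>B. g w *s w)"
    and "w \<in> B"
  shows "g w * l w = c * \<sigma> (g w)"
proof -
  have "(\<Sum>w\<in>B. g w *s w) v* M = (\<Sum>w\<in>B. (g w * l w) *s map_coords \<sigma> w)"
    by (simp add: vector_matrix_mult_sum scalar_vector_matrix_assoc eig vector_smult_assoc)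
  moreover have "c *s map_coords \<sigma> (\<Sum>w\<in>B. g w *s w) = (\<Sum>w\<in>B. (c * \<sigma> (g w)) *s map_coords \<sigma> w)"
    by (simp add: map_coords_sum[OF aut] map_coords_scale[OF aut] vec.scale_sum_right
        vector_smult_assoc)
  ultimately have "(\<Sum>w\<in>B. (g w * l w - c * \<sigma> (g w)) *s map_coords \<sigma> w) = 0"
    using v by (simp add: vec.scale_left_diff_distrib sum_subtractf)
  from independent_map_coords[OF aut ind fin this \<open>w \<in> B\<close>] show ?thesis by simp
qed

text \<open>Adding \<open>b\<close> to \<open>B\<close> creates at most \<open>s ^ card B\<close>
  new points: a representative with coefficient 1 at \<open>b\<close> must have eigenvalue
  \<open>l b\<close>, which leaves at most \<open>s\<close> values for each other coefficient. The
  lemma is also applied to \<open>id\<close> and \<open>mat 1\<close>, where it bounds the number of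
  points of a subspace.\<close>

lemma card_eigenpoints_span_le:
  fixes B :: "('a::{field,finite} ^ 'n) set"
  assumes aut: "field_automorphism \<sigma>" and "finite B" and "vec.independent B"
    and "\<And>b. b \<in> B \<Longrightarrow> l b \<noteq> 0 \<and> b v* M = l b *s map_coords \<sigma> b"
  shows "card (proj_point ` {v \<in> vec.span B. v \<noteq> 0 \<and> (\<exists>c. v v* M = c *s map_coords \<sigma> v)})
           \<le> (\<Sum>i<card B. card (fixed_field \<sigma>) ^ i)"
  using assms(2-)
proof (induction B rule: finite_induct)
  case (insert b B)
  let ?A = "\<lambda>B. {v \<in> vec.span B. v \<noteq> 0 \<and> (\<exists>c. v v* M = c *s map_coords \<sigma> v)}"
  define X where "X = PiE B (\<lambda>w. {x. x * l w = l b * \<sigma> x})"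
  define p where "p f = proj_point (b + (\<Sum>w\<in>B. f w *s w))" for f
  have eig: "\<And>w. w \<in> insert b B \<Longrightarrow> w v* M = l w *s map_coords \<sigma> w"
    and lb: "l b \<noteq> 0" using insert.prems by auto
  have ind: "vec.independent B"
    using insert.prems(1) by (rule vec.independent_mono) auto
  have "proj_point ` ?A (insert b B) \<subseteq> proj_point ` ?A B \<union> p ` X"
  proof clarify
    fix v c
    assume v: "v \<in> vec.span (insert b B)" "v \<noteq> 0" and c: "v v* M = c *s map_coords \<sigma> v"
      and notX: "proj_point v \<notin> p ` X"
    obtain k where k: "v - k *s b \<in> vec.span B" using v vec.span_breakdown_eq by blast
    have "k = 0"
    proof (rule ccontr)
      assume "k \<noteq> 0"
      then have "\<sigma> k \<noteq> 0" by (simp add: aut_eq_zero_iff[OF aut])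
      have "inverse k *s (v - k *s b) \<in> vec.span B" using k by (rule vec.span_scale)
      then obtain f where f: "inverse k *s (v - k *s b) = (\<Sum>w\<in>B. f w *s w)"
        using vec.span_finite[OF \<open>finite B\<close>] by auto
      have fv: "inverse k *s v = b + (\<Sum>w\<in>B. f w *s w)"
        using f \<open>k \<noteq> 0\<close> by (simp add: vec.scale_right_diff_distrib vector_smult_assoc algebra_simps)
      define g where "g = f(b := 1)"
      have gv: "(\<Sum>w\<in>insert b B. g w *s w) = inverse k *s v"
        using insert.hyps by (simp add: fv g_def) (auto intro!: sum.cong)
      \<comment> \<open>Rescaling a vector by \<open>inverse k\<close> changes its twisted
        eigenvalue by this factor, because \<open>map_coords \<sigma>\<close> is only
        semilinear.\<close>
      define c' where "c' = inverse k * c * \<sigma> k"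
      have "v = k *s (inverse k *s v)" using \<open>k \<noteq> 0\<close> by (simp add: vector_smult_assoc)
      then have "map_coords \<sigma> v = \<sigma> k *s map_coords \<sigma> (inverse k *s v)"
        by (metis map_coords_scale[OF aut])
      then have "(inverse k *s v) v* M = c' *s map_coords \<sigma> (inverse k *s v)"
        by (simp add: scalar_vector_matrix_assoc c c'_def vector_smult_assoc mult.assoc)
      then have coeff: "g w * l w = c' * \<sigma> (g w)" if "w \<in> insert b B" for w
        using eigenvector_coefficients[OF aut insert.prems(1) _ eig, of g c' w] insert.hyps that gv
        by simp
      \<comment> \<open>The coefficient 1 is fixed by \<sigma>, so comparison at \<open>b\<close>
        determines the eigenvalue.\<close>
      have c': "c' = l b" using coeff[of b] by (simp add: g_def aut_one[OF aut])
      have "f w * l w = l b * \<sigma> (f w)" if "w \<in> B" for w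
        using coeff[of w] that insert.hyps c' by (auto simp: g_def split: if_splits)
      then have "restrict f B \<in> X" by (auto simp: X_def)
      moreover have "p (restrict f B) = proj_point v"
        using fv proj_point_scale[of "inverse k" v] \<open>k \<noteq> 0\<close> by (simp add: p_def cong: sum.cong)
      ultimately show False using notX by (metis imageI)
    qed
    then show "proj_point v \<in> proj_point ` ?A B" using k v c by auto
  qed
  then have "card (proj_point ` ?A (insert b B)) \<le> card (proj_point ` ?A B \<union> p ` X)"
    by (intro card_mono) simp_all
  also have "\<dots> \<le> card (proj_point ` ?A B) + card (p ` X)" by (rule card_Un_le)
  also have "\<dots> \<le> (\<Sum>i<card B. card (fixed_field \<sigma>) ^ i) + card (fixed_field \<sigma>) ^ card B"
  proof (rule add_mono)
    show "card (proj_point ` ?A B) \<le> (\<Sum>i<card B. card (fixed_field \<sigma>) ^ i)"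
      using insert.IH[OF ind] insert.prems(2) by simp
    have finX: "finite X" unfolding X_def using insert.hyps(1) by (intro finite_PiE) auto
    have "card X = (\<Prod>w\<in>B. card {x. x * l w = l b * \<sigma> x})"
      unfolding X_def by (rule card_PiE[OF insert.hyps(1)])
    also have "\<dots> \<le> (\<Prod>w\<in>B. card (fixed_field \<sigma>))"
      by (intro prod_mono) (auto intro: card_twisted_solutions_le[OF aut lb])
    finally have "card X \<le> card (fixed_field \<sigma>) ^ card B" by simp
    then show "card (p ` X) \<le> card (fixed_field \<sigma>) ^ card B"
      using card_image_le[OF finX, of p] by simp
  qed
  finally show ?case using insert.hyps by simp
qed simp

text \<open>Here \<open>k\<close> is the dimension of the left kernel of \<open>M\<close>, and
  \<open>m\<close> the largest number of independent vectors with nonzero twisted eigenvalue that a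
  maximal choice \<open>B\<close> supplies, that is \<open>card B\<close>. Only a numerical
  optimisation over \<open>k\<close> and \<open>m\<close> then remains.\<close>

lemma theta_le:
  fixes M :: "'a::{field,finite} ^ 'n ^ 'n"
  assumes aut: "field_automorphism \<sigma>" and "M \<noteq> 0"
  obtains k m where "k < CARD('n)" "k + m \<le> CARD('n)"
    "theta \<sigma> M \<le> (\<Sum>i<k. CARD('a) ^ i) + (\<Sum>i<m. card (fixed_field \<sigma>) ^ i)"
proof -
  define E where "E = {v. v \<noteq> 0 \<and> (\<exists>c. c \<noteq> 0 \<and> v v* M = c *s map_coords \<sigma> v)}"
  define K where "K = {v. v v* M = 0}"
  obtain B where B: "B \<subseteq> E" "vec.independent B" "E \<subseteq> vec.span B"
    using vec.maximal_independent_subset by blast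
  obtain C where C: "C \<subseteq> K" "vec.independent C" "K \<subseteq> vec.span C"
    using vec.maximal_independent_subset by blast
  obtain l where l: "\<And>b. b \<in> B \<Longrightarrow> l b \<noteq> 0 \<and> b v* M = l b *s map_coords \<sigma> b"
    using B(1) unfolding E_def by (simp add: subset_iff) metis
  have subK: "vec.subspace K"
    by (rule vec.subspaceI)
      (auto simp: K_def scalar_vector_matrix_assoc algebra_simps)
  have spanC: "vec.span C = K"
    using C subK by (intro equalityI vec.span_minimal) auto
  have disj: "vec.span B \<inter> K = {0}"
  proof -
    have "v = 0" if "v \<in> vec.span B" "v \<in> K" for v
    proof -
      have "v \<in> range (\<lambda>g. \<Sum>w\<in>B. g w *s w)"
        using that(1) vec.span_finite[OF finite, of B] by simp
      then obtain g where g: "v = (\<Sum>w\<in>B. g w *s w)" by blast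
      have "(\<Sum>w\<in>B. g w *s w) v* M = 0 *s map_coords \<sigma> (\<Sum>w\<in>B. g w *s w)"
        using that g by (simp add: K_def)
      \<comment> \<open>A kernel vector satisfies the eigenvector equation with scalar 0, while
        every \<open>l w\<close> is nonzero.\<close>
      then have "g w * l w = 0" if "w \<in> B" for w
        using eigenvector_coefficients[OF aut B(2), of M l g 0 w] l that by simp
      then have "g w = 0" if "w \<in> B" for w using l that by fastforce
      then show ?thesis using g by simp
    qed
    then show ?thesis using vec.span_zero vec.subspace_0[OF subK] by auto
  qed
  have dims: "card C + card B \<le> CARD('n)"
  proof -
    have "card B + card C = vec.dim (vec.span B) + vec.dim (vec.span C)"
      using B C by (simp add: vec.dim_eq_card_independent)
    also have "\<dots> = vec.dim {x + y |x y. x \<in> vec.span B \<and> y \<in> K} + vec.dim (vec.span B \<inter> K)"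
      unfolding spanC using vec.dim_sums_Int[OF _ subK] by simp
    also have "\<dots> \<le> CARD('n)" by (simp add: disj dim_subset_UNIV_cart_gen)
    finally show ?thesis by simp
  qed
  have cardC: "card C < CARD('n)"
  proof (rule ccontr)
    assume "\<not> ?thesis"
    then have "vec.dim (UNIV :: ('a ^ 'n) set) \<le> vec.dim K"
      using spanC vec.dim_span_eq_card_independent[OF C(2)]
        dim_subset_UNIV_cart_gen[of "UNIV :: ('a ^ 'n) set"] by simp
    then have "K = UNIV" using subK by (intro vec.subspace_dim_equal) auto
    \<comment> \<open>The unit row vectors pick out the rows of \<open>M\<close>.\<close>
    then have "axis i 1 v* M = 0" for i by (auto simp: K_def)
    then have "M = 0"
      by (simp add: vec_eq_iff vector_matrix_mult_def axis_def if_distrib[of "\<lambda>x. x * _"] cong: if_cong)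
    then show False using assms by simp
  qed
  \<comment> \<open>Every vector is an eigenvector of \<open>mat 1\<close> for the identity
    automorphism, so the kernel points fit the same count, with the whole field as fixed
    field.\<close>
  have "theta \<sigma> M \<le> card (proj_point `
      {v \<in> vec.span C. v \<noteq> 0 \<and> (\<exists>c. v v* mat 1 = c *s map_coords id v)} \<union> proj_point `
      {v \<in> vec.span B. v \<noteq> 0 \<and> (\<exists>c. v v* M = c *s map_coords \<sigma> v)})"
  proof -
    have "v v* mat 1 = 1 *s map_coords id v" for v :: "'a ^ 'n"
      by (simp add: vec_eq_iff map_coords_def)
    then have id: "\<exists>c. v v* mat 1 = c *s map_coords id v" for v :: "'a ^ 'n" by blast
    have "v \<in> vec.span C \<or> v \<in> vec.span B" if "v \<noteq> 0" "v v* M = c *s map_coords \<sigma> v" for v c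
      using that B(3) C(3) by (cases "c = 0") (auto simp: K_def E_def)
    then show ?thesis unfolding theta_eq[OF aut] image_Un[symmetric]
      by (intro card_mono image_mono) (use id in auto)
  qed
  also have "\<dots> \<le> (\<Sum>i<card C. card (fixed_field (id :: 'a \<Rightarrow> 'a)) ^ i) +
      (\<Sum>i<card B. card (fixed_field \<sigma>) ^ i)"
    by (rule order.trans[OF card_Un_le], intro add_mono
        card_eigenpoints_span_le[where l = "\<lambda>_. 1"] card_eigenpoints_span_le[where l = l])
      (use B C l aut in \<open>auto simp: field_automorphism_id vec_eq_iff map_coords_def\<close>)
  finally show ?thesis
    using that[OF cardC dims] by (simp add: fixed_field_id)
qed

section \<open>Extremal matrices\<close>

text \<open>The nonzero vectors in question number \<open>s ^ N - 1\<close> with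
  \<open>N = CARD('n) - card Z\<close>, and at most \<open>s - 1\<close> of them span the same
  point. With \<open>id\<close> in place of \<sigma> this counts points over the full field.\<close>

lemma card_subgeometry_points_ge:
  fixes \<sigma> :: "'a::{field,finite} \<Rightarrow> 'a" and Z :: "'n::finite set"
  assumes aut: "field_automorphism \<sigma>"
  shows "(\<Sum>i<CARD('n) - card Z. card (fixed_field \<sigma>) ^ i) \<le>
    card (proj_point ` {\<xi> :: 'a ^ 'n. \<xi> \<noteq> 0 \<and> (\<forall>i. \<xi> $ i \<in> fixed_field \<sigma>) \<and> (\<forall>i\<in>Z. \<xi> $ i = 0)})"
    (is "?S \<le> card (proj_point ` ?A)")
proof -
  let ?T = "fixed_field \<sigma>"
  let ?N = "CARD('n) - card Z"
  \<comment> \<open>Including the zero vector turns the set into a product over the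
    coordinates.\<close>
  have "card (insert 0 ?A) = card (PiE UNIV (\<lambda>i::'n. if i \<in> Z then {0} else ?T))"
    by (rule bij_betw_same_card[of vec_nth], rule bij_betw_byWitness[where f' = vec_lambda])
      (use zero_one_in_fixed_field[OF aut] in \<open>auto simp: PiE_def Pi_def split: if_splits\<close>)
  also have "\<dots> = (\<Prod>i\<in>(UNIV :: 'n set). if i \<in> Z then 1 else card ?T)"
    by (subst card_PiE) (auto intro!: prod.cong)
  also have "\<dots> = card ?T ^ ?N"
    by (simp add: prod.If_cases card_Diff_subset Compl_eq_Diff_UNIV)
  finally have cardA: "Suc (card ?A) = card ?T ^ ?N" by simp
  have "card ?A = (\<Sum>P\<in>proj_point ` ?A. card {\<xi> \<in> ?A. proj_point \<xi> = P})"
    using sum.image_gen[of ?A "\<lambda>_. 1::nat" proj_point] by simp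
  also have "\<dots> \<le> (\<Sum>P\<in>proj_point ` ?A. card ?T - 1)"
  proof (rule sum_mono)
    fix P assume "P \<in> proj_point ` ?A"
    then obtain \<xi> where \<xi>: "\<xi> \<in> ?A" "P = proj_point \<xi>" by blast
    obtain i where i: "\<xi> $ i \<noteq> 0" using \<xi> by (auto simp: vec_eq_iff)
    have "{\<eta> \<in> ?A. proj_point \<eta> = P} \<subseteq> (\<lambda>c. c *s \<xi>) ` (?T - {0})"
    proof
      fix \<eta> assume "\<eta> \<in> {\<eta> \<in> ?A. proj_point \<eta> = P}"
      then have \<eta>: "\<eta> \<noteq> 0" "\<forall>i. \<eta> $ i \<in> ?T" "proj_point \<eta> = P" by auto
      obtain c where c: "\<eta> = c *s \<xi>" using proj_point_eqD[of \<xi> \<eta>] \<eta> \<xi> by metis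
      \<comment> \<open>Proportional vectors with fixed coordinates differ by a fixed
        scalar.\<close>
      then have "c = \<eta> $ i / \<xi> $ i" using i by simp
      then have "c \<in> ?T" using \<eta> \<xi> fixed_field_closed[OF aut] by simp
      moreover have "c \<noteq> 0" using c \<eta> by auto
      ultimately show "\<eta> \<in> (\<lambda>c. c *s \<xi>) ` (?T - {0})" using c by auto
    qed
    then have "card {\<eta> \<in> ?A. proj_point \<eta> = P} \<le> card (?T - {0})"
      by (intro surj_card_le) auto
    then show "card {\<eta> \<in> ?A. proj_point \<eta> = P} \<le> card ?T - 1"
      using zero_one_in_fixed_field[OF aut] by simp
  qed
  finally have "card ?A \<le> (card ?T - 1) * card (proj_point ` ?A)" by (simp add: mult.commute)
  moreover have "card ?A = (card ?T - 1) * ?S"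
  proof -
    obtain t where t: "card ?T = Suc t" using card_fixed_field_ge_2[OF aut] by (cases "card ?T") auto
    have "Suc t ^ N = Suc (t * (\<Sum>i<N. Suc t ^ i))" for N
      by (induction N) (simp_all add: algebra_simps)
    from this[of ?N] show ?thesis using cardA unfolding t by simp
  qed
  moreover have "0 < card ?T - 1" using card_fixed_field_ge_2[OF aut] by simp
  ultimately show ?thesis by (simp only: mult_le_cancel1)
qed

text \<open>Vectors over the fixed field are unchanged by \<sigma>, so they satisfy the equation for
  the identity matrix with scalar 1.\<close>

lemma theta_mat_1_ge:
  fixes \<sigma> :: "'a::{field,finite} \<Rightarrow> 'a"
  assumes aut: "field_automorphism \<sigma>"
  shows "(\<Sum>i<CARD('n). card (fixed_field \<sigma>) ^ i) \<le> theta \<sigma> (mat 1 :: 'a ^ 'n ^ 'n)"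
proof -
  have "\<xi> v* mat 1 = 1 *s map_coords \<sigma> \<xi>" if "\<forall>i. \<xi> $ i \<in> fixed_field \<sigma>" for \<xi> :: "'a ^ 'n"
    using that by (simp add: vec_eq_iff map_coords_def fixed_field_def)
  then have "proj_point ` {\<xi> :: 'a ^ 'n. \<xi> \<noteq> 0 \<and> (\<forall>i. \<xi> $ i \<in> fixed_field \<sigma>) \<and> (\<forall>i\<in>{}. \<xi> $ i = 0)}
      \<subseteq> proj_point ` {\<xi>. \<xi> \<noteq> 0 \<and> (\<exists>c. \<xi> v* mat 1 = c *s map_coords \<sigma> \<xi>)}"
    by (intro image_mono) blast
  from card_mono[OF _ this] card_subgeometry_points_ge[OF aut, of "{} :: 'n set"]
  show ?thesis by (simp add: theta_eq[OF aut])
qed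

text \<open>The left kernel of the matrix unit is the hyperplane where coordinate \<open>k\<close>
  vanishes; the point of \<open>axis k 1\<close> lies off it and contributes the extra 1.\<close>

lemma theta_matrix_unit_ge:
  fixes \<sigma> :: "'a::{field,finite} \<Rightarrow> 'a" and k :: "'n::finite"
  assumes aut: "field_automorphism \<sigma>"
  defines "M \<equiv> (\<chi> i j. if i = k \<and> j = k then 1 else 0) :: 'a ^ 'n ^ 'n"
  shows "(\<Sum>i<CARD('n) - 1. CARD('a) ^ i) + 1 \<le> theta \<sigma> M"
proof -
  let ?A = "{\<xi> :: 'a ^ 'n. \<xi> \<noteq> 0 \<and> (\<forall>i. \<xi> $ i \<in> fixed_field id) \<and> (\<forall>i\<in>{k}. \<xi> $ i = 0)}"
  have mult: "\<xi> v* M = \<xi> $ k *s axis k 1" for \<xi>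
    by (simp add: vec_eq_iff vector_matrix_mult_def M_def axis_def if_distrib cong: if_cong)
  have "axis k 1 v* M = 1 *s map_coords \<sigma> (axis k 1)"
    by (simp add: mult) (simp add: vec_eq_iff map_coords_def axis_def aut_zero[OF aut] aut_one[OF aut])
  then have ax: "\<exists>c. axis k 1 v* M = c *s map_coords \<sigma> (axis k 1)" by blast
  have A: "\<xi> v* M = 0 *s map_coords \<sigma> \<xi>" if "\<xi> \<in> ?A" for \<xi>
    using that by (simp add: mult)
  have new: "proj_point (axis k 1) \<notin> proj_point ` ?A"
  proof
    assume "proj_point (axis k 1) \<in> proj_point ` ?A"
    then obtain \<xi> where "\<xi> \<in> ?A" and eq: "proj_point (axis k 1) = proj_point \<xi>" by (rule imageE)
    moreover obtain c where "axis k 1 = c *s \<xi>" using proj_point_eqD[OF eq[symmetric]] by blast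
    ultimately have "(axis k 1 :: 'a ^ 'n) $ k = 0" by simp
    then show False by (simp add: axis_def)
  qed
  have "(\<Sum>i<CARD('n) - 1. CARD('a) ^ i) + 1 \<le> Suc (card (proj_point ` ?A))"
    using card_subgeometry_points_ge[OF field_automorphism_id, of "{k}"] by (simp add: fixed_field_id)
  also have "\<dots> = card (insert (proj_point (axis k 1)) (proj_point ` ?A))" using new by simp
  also have "\<dots> = card (proj_point ` insert (axis k 1) ?A)" by simp
  also have "\<dots> \<le> theta \<sigma> M" unfolding theta_eq[OF aut]
    by (intro card_mono image_mono) (use A ax in \<open>auto simp: axis_eq_0_iff\<close>)
  finally show ?thesis .
qed

section \<open>Comparison of the geometric sums\<close>

text \<open>The worst \<open>m\<close> is \<open>n + 1 - k\<close>. For positive \<open>k\<close>,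
  each surplus power of \<open>s\<close> is dominated by a missing power of \<open>q\<close>. For
  \<open>k = 0\<close> this pairing breaks down, and the hypothesis on \<open>s ^ n + s\<close>
  takes over.\<close>

lemma geometric_sums_le:
  fixes q s n k m :: nat
  assumes "2 \<le> s" "s ^ 2 \<le> q" "s ^ n + s \<le> q ^ (n - 1)" "2 \<le> n" "k \<le> n" "k + m \<le> n + 1"
  shows "(\<Sum>i<k. q ^ i) + (\<Sum>i<m. s ^ i) \<le> (\<Sum>i<n. q ^ i) + 1"
proof -
  have "s \<le> q" using self_le_power[of s 2] assms(1,2) by linarith
  obtain d where d: "n = k + d" using \<open>k \<le> n\<close> le_Suc_ex by blast
  have "(\<Sum>i<m. s ^ i) \<le> (\<Sum>i<Suc d. s ^ i)"
    using assms(6) d by (intro sum_mono2) auto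
  moreover have "(\<Sum>i<k. q ^ i) + (\<Sum>i<Suc d. s ^ i) \<le> (\<Sum>i<n. q ^ i) + 1"
  proof (cases "k = 0")
    case False
    have "(\<Sum>i<k. q ^ i) + (\<Sum>i<Suc d. s ^ i) \<le> (\<Sum>i<k + d. q ^ i) + 1"
    proof (induction d)
      case (Suc d)
      have "s ^ Suc d \<le> q ^ Suc d" using \<open>s \<le> q\<close> by (intro power_mono) auto
      also have "\<dots> \<le> q ^ (k + d)" using False assms \<open>s \<le> q\<close> by (intro power_increasing) auto
      finally show ?case using Suc by simp
    qed simp
    then show ?thesis using d by simp
  next
    case True
    \<comment> \<open>From \<open>s ^ 2 \<le> q\<close>, the power \<open>s ^ (j + 2)\<close> is
      paired with \<open>q ^ (j + 1)\<close>; the shift by one leaves the single term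
      \<open>s\<close> unpaired.\<close>
    have "(\<Sum>i<Suc (Suc j). s ^ i) \<le> (\<Sum>i<Suc j. q ^ i) + s" for j
    proof (induction j)
      case (Suc j)
      have "s ^ Suc (Suc j) \<le> s ^ (2 * Suc j)" using assms by (intro power_increasing) auto
      also have "\<dots> \<le> q ^ Suc j"
        unfolding power_mult using assms(2) by (intro power_mono) auto
      finally show ?case using Suc by simp
    qed simp
    from this[of "n - 2"] have "(\<Sum>i<n. s ^ i) \<le> (\<Sum>i<n - 1. q ^ i) + s"
      using assms(4) by (simp add: Suc_diff_Suc numeral_2_eq_2 del: sum.lessThan_Suc)
    moreover have "(\<Sum>i<n. q ^ i) = (\<Sum>i<n - 1. q ^ i) + q ^ (n - 1)"
      using assms(4) sum.lessThan_Suc[of "\<lambda>i. q ^ i" "n - 1"] by simp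
    ultimately show ?thesis using True d assms(3) by simp
  qed
  ultimately show ?thesis by simp
qed

text \<open>The left side is at most \<open>s ^ (n + 1)\<close>. For \<open>n > 2\<close> one has
  \<open>n + 1 \<le> 2 * (n - 1)\<close>, so \<open>s ^ 2 \<le> q\<close> suffices; for
  \<open>n = 2\<close> the claim becomes \<open>s ^ 3 \<le> q\<close>.\<close>

lemma power_plus_le_power:
  fixes q s n :: nat
  assumes "2 \<le> s" "s ^ 2 \<le> q" "2 < n \<or> s ^ 3 \<le> q" "2 \<le> n"
  shows "s ^ n + s \<le> q ^ (n - 1)"
proof -
  have "s ^ 1 \<le> s ^ n" using assms by (intro power_increasing) auto
  then have "s ^ n + s \<le> 2 * s ^ n" by simp
  also have "\<dots> \<le> s ^ Suc n" using assms by simp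
  also have "\<dots> \<le> q ^ (n - 1)"
  proof (cases "2 < n")
    case True
    then have "s ^ Suc n \<le> s ^ (2 * (n - 1))" using assms by (intro power_increasing) auto
    also have "\<dots> \<le> q ^ (n - 1)" using assms(2) by (simp add: power_mult power_mono)
    finally show ?thesis .
  next
    case False
    then have "n = 2" using assms(4) by simp
    then show ?thesis using False assms(3) by (simp add: power2_eq_square power3_eq_cube)
  qed
  finally show ?thesis .
qed

section \<open>Matching the bounds in the two cases\<close>

theorem theorem3p11:
  fixes \<sigma> :: "'a::{field,finite} \<Rightarrow> 'a"
    and q s n :: nat
  assumes "q = CARD('a)"
    and "CARD('n::finite) = n + 1"
    and "n \<ge> 2"
    and "field_automorphism \<sigma>"
    and "\<sigma> \<noteq> id"
    and "s = card (fixed_field \<sigma>)"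
  shows "(\<sigma> \<circ> \<sigma> = id \<and> n = 2 \<longrightarrow>
            real (Max {theta \<sigma> M | M :: 'a ^ 'n ^ 'n. M \<noteq> 0}) = m_val q s n 3 \<and>
            m_val q s n 3 = real s ^ 2 + real s + 1) \<and>
         (\<sigma> \<circ> \<sigma> \<noteq> id \<or> n > 2 \<longrightarrow>
            real (Max {theta \<sigma> M | M :: 'a ^ 'n ^ 'n. M \<noteq> 0}) = m_val q s n 1 \<and>
            m_val q s n 1 = (real q ^ n - 1) / (real q - 1) + 1)"
proof -
  note aut = \<open>field_automorphism \<sigma>\<close>
  obtain a where a: "\<sigma> a \<noteq> a" using \<open>\<sigma> \<noteq> id\<close> by (auto simp: fun_eq_iff)
  have s2: "2 \<le> s" using card_fixed_field_ge_2[OF aut] assms by simp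
  have sq: "s ^ 2 \<le> q" using card_fixed_field_square_le[OF aut a] assms by simp
  have MaxI: "Max {theta \<sigma> M | M :: 'a ^ 'n ^ 'n. M \<noteq> 0} = t"
    if M0: "(M0 :: 'a ^ 'n ^ 'n) \<noteq> 0" and lower: "t \<le> theta \<sigma> M0"
      and upper: "\<And>k m. k \<le> n \<Longrightarrow> k + m \<le> n + 1 \<Longrightarrow> (\<Sum>i<k. q ^ i) + (\<Sum>i<m. s ^ i) \<le> t" for M0 t
  proof -
    have le: "theta \<sigma> M \<le> t" if M: "M \<noteq> 0" for M :: "'a ^ 'n ^ 'n"
    proof -
      obtain k m where "k < CARD('n)" "k + m \<le> CARD('n)"
        and 1: "theta \<sigma> M \<le> (\<Sum>i<k. q ^ i) + (\<Sum>i<m. s ^ i)"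
        using theta_le[OF aut M] assms by metis
      then have "(\<Sum>i<k. q ^ i) + (\<Sum>i<m. s ^ i) \<le> t" using assms by (intro upper) auto
      with 1 show ?thesis by simp
    qed
    have "theta \<sigma> M0 = t" using le[OF M0] lower by simp
    show ?thesis
    proof (rule Max_eqI)
      show "finite {theta \<sigma> M | M :: 'a ^ 'n ^ 'n. M \<noteq> 0}" by simp
      show "y \<le> t" if "y \<in> {theta \<sigma> M | M :: 'a ^ 'n ^ 'n. M \<noteq> 0}" for y using that le by auto
      show "t \<in> {theta \<sigma> M | M :: 'a ^ 'n ^ 'n. M \<noteq> 0}" using M0 \<open>theta \<sigma> M0 = t\<close> by blast
    qed
  qed
  show ?thesis
  proof (intro conjI impI; (elim conjE)?)
    assume ss: "\<sigma> \<circ> \<sigma> = id" and n: "n = 2"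
    have qs: "q \<le> s ^ 2" using card_le_fixed_field_square[OF aut a ss] assms by simp
    \<comment> \<open>For \<open>n = 2\<close> the power of \<open>q\<close> in
      \<open>m_val q s n 3\<close> has exponent 0, so only the quotient in \<open>s\<close>
      survives.\<close>
    have "(real s ^ 3 - 1) = (real s - 1) * (real s ^ 2 + real s + 1)"
      by (simp add: power2_eq_square power3_eq_cube algebra_simps)
    then show m: "m_val q s n 3 = real s ^ 2 + real s + 1"
      using n s2 by (simp add: m_val_def)
    have "Max {theta \<sigma> M | M :: 'a ^ 'n ^ 'n. M \<noteq> 0} = s ^ 2 + s + 1"
    proof (rule MaxI)
      show "mat 1 \<noteq> (0 :: 'a ^ 'n ^ 'n)" by (simp add: vec_eq_iff mat_def)
      show "s ^ 2 + s + 1 \<le> theta \<sigma> (mat 1 :: 'a ^ 'n ^ 'n)"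
        using theta_mat_1_ge[OF aut, where 'n = 'n] assms n
        by (simp add: numeral_3_eq_3 power2_eq_square algebra_simps)
      fix k m assume km: "k \<le> n" "k + m \<le> n + 1"
      have "(\<Sum>i<m. s ^ i) \<le> (\<Sum>i<3 - k. s ^ i)" using km n by (intro sum_mono2) auto
      moreover have "(\<Sum>i<k. q ^ i) + (\<Sum>i<3 - k. s ^ i) \<le> s ^ 2 + s + 1"
      proof -
        \<comment> \<open>Equality holds at \<open>k = 0\<close>. The value \<open>q + 2\<close> at
          \<open>k = 2\<close> is where \<open>q \<le> s ^ 2\<close> enters.\<close>
        consider "k = 0" | "k = 1" | "k = 2" using km n by linarith
        then show ?thesis
          using qs s2 by cases (simp_all add: numeral_3_eq_3 numeral_2_eq_2)
      qed
      ultimately show "(\<Sum>i<k. q ^ i) + (\<Sum>i<m. s ^ i) \<le> s ^ 2 + s + 1" by simp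
    qed
    then show "real (Max {theta \<sigma> M | M :: 'a ^ 'n ^ 'n. M \<noteq> 0}) = m_val q s n 3"
      using m by simp
  next
    assume cond: "\<sigma> \<circ> \<sigma> \<noteq> id \<or> n > 2"
    show m: "m_val q s n 1 = (real q ^ n - 1) / (real q - 1) + 1"
      using s2 by (simp add: m_val_def)
    fix k0 :: 'n
    have "Max {theta \<sigma> M | M :: 'a ^ 'n ^ 'n. M \<noteq> 0} = (\<Sum>i<n. q ^ i) + 1"
    proof (rule MaxI)
      let ?M = "(\<chi> i j. if i = k0 \<and> j = k0 then 1 else 0) :: 'a ^ 'n ^ 'n"
      show "?M \<noteq> 0" by (auto simp: vec_eq_iff)
      show "(\<Sum>i<n. q ^ i) + 1 \<le> theta \<sigma> ?M"
        using theta_matrix_unit_ge[OF aut, of k0] assms by simp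
      \<comment> \<open>When \<open>n = 2\<close> the automorphism is not an involution, and the
        cubic bound on \<open>s\<close> replaces the quadratic one.\<close>
      have "2 < n \<or> s ^ 3 \<le> q" using cond card_fixed_field_cube_le[OF aut a] assms by auto
      then show "(\<Sum>i<k. q ^ i) + (\<Sum>i<m. s ^ i) \<le> (\<Sum>i<n. q ^ i) + 1"
        if "k \<le> n" "k + m \<le> n + 1" for k m
        using geometric_sums_le power_plus_le_power s2 sq \<open>n \<ge> 2\<close> that by blast
    qed
    moreover have "real (\<Sum>i<n. q ^ i) = (real q ^ n - 1) / (real q - 1)"
    proof -
      have "s < s ^ 2" using s2 by (simp add: power2_eq_square)
      then have "real q \<noteq> 1" using s2 sq by simp
      then show ?thesis using geometric_sum[of "real q" n] by simp
    qed
    ultimately show "real (Max {theta \<sigma> M | M :: 'a ^ 'n ^ 'n. M \<noteq> 0}) = m_val q s n 1"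
      using m by simp
  qed
qed

end
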